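(* Let $r$ be a vertex symbol and let $\mathcal{Q}(r)$ be the set of bidirected graphs defined inductively by: (1) the bidirected graph consisting of the single vertex $r$ and no edge belongs to $\mathcal{Q}(r)$; (2) if $H\in\mathcal{Q}(r)$ and $P$ is a diear relative to $H$ (a diwalk in some bidirected graph having $H$ as a subgraph), then $H+P\in\mathcal{Q}(r)$. Then $\mathcal{Q}(r)$ is exactly the set of absolute semiradials with root $r$.
   Context: A bidirected graph $G$ is a finite graph (loops and parallel edges allowed) with maps $\partial_+,\partial_-:E(G)\to 2^{V(G)}$ such that for each edge $e$ with (possibly identical) ends $u,v$: $\partial_\alpha(e)\subseteq\{u,v\}$ for $\alpha\in\{+,-\}$, $\partial_+(e)\cup\partial_-(e)=\{u,v\}$, and $\partial_+(e)\cap\partial_-(e)=\emptyset$ if $e$ is not a loop. If $u\in\partial_\alpha(e)$, the sign of $u$ over $e$ is $\alpha$; $-\alpha$ denotes the opposite sign. A walk is a sequence $W=(w_1,\dots,w_k)$, $k$ odd, with $w_i$ a vertex for odd $i$ and $w_i$ an edge joining $w_{i-1}$ and $w_{i+1}$ for even $i$; it goes from $w_1$ to $w_k$, and is closed over $r$ if $w_1=w_k=r$. A trail is a walk with no repeated edge. $W$ is a diwalk if to each traversal of an edge $w_i$ ($i$ even) one can assign signs to its end-occurrences $w_{i-1},w_{i+1}$ equal to the signs of these vertices over $w_i$ (for a loop having one end sign $+$ and the other $-$, the two assigned signs are distinct), such that at every internal vertex term $w_i$ ($i$ odd, $1<i<k$) the signs assigned from $w_{i-1}$ and from $w_{i+1}$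 are distinct. A ditrail is a diwalk that is a trail. For $k\ge3$ the sign of $w_1$ (resp. $w_k$) over $W$ is the sign assigned to it at edge $w_2$ (resp. $w_{k-1}$); $W$ is an $(\alpha,\beta)$-ditrail if these are $\alpha,\beta$, and an $\alpha$-ditrail if it is an $(\alpha,\beta)$-ditrail for some $\beta$. The trivial ditrail $(v)$ counts as both a $(+,-)$- and a $(-,+)$-ditrail. $G$ is an $\alpha$-semiradial with root $r\in V(G)$ if every $v\in V(G)$ has an $\alpha$-ditrail from $v$ to $r$; $G$ is an absolute semiradial with root $r$ if it is an $\alpha$-semiradial with root $r$ for both $\alpha\in\{+,-\}$. For a subgraph $H$, a diear relative to $H$ is a diwalk $W$ whose ends lie in $V(H)$, whose edges are not edges of $H$, and which either (i) is a ditrail (simple diear), or (ii) has the form $(v,e,w_3,\dots,w_{k-2},e,v)$ with $k\ge7$, where $e$ joins a vertex of $V(H)$ to a vertex not in $V(H)$ and $(w_3,\dots,w_{k-2})$ is a closed ditrail not containing $e$ (scoop diear with grip $e$). $H+W$ is the graph obtained from $H$ by adding the vertices and edges of $W$. *)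

theory Defs
  imports Main
begin

datatype sign = Plus | Minus

text \<open>
  \<open>bd \<alpha> e\<close> is the set \<open>\<partial>\<^sub>\<alpha>(e)\<close> of ends of \<open>e\<close> that have sign \<open>\<alpha>\<close> over \<open>e\<close>. The values of \<open>ends\<close> and \<open>bd\<close>
  matter on \<open>edges\<close> only; records that differ elsewhere represent the same graph, and no notion
  below distinguishes them.
\<close>

record ('v, 'e) bigraph =
  verts :: "'v set"
  edges :: "'e set"
  ends :: "'e \<Rightarrow> 'v set"
  bd :: "sign \<Rightarrow> 'e \<Rightarrow> 'v set"

definition is_loop :: "('v, 'e) bigraph \<Rightarrow> 'e \<Rightarrow> bool" where
  "is_loop G e \<longleftrightarrow> (\<exists>v. ends G e = {v})"

locale bidirected_graph =
  fixes G :: "('v, 'e) bigraph"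
  assumes finite_verts: "finite (verts G)"
    and finite_edges: "finite (edges G)"
    and ends_pair: "e \<in> edges G \<Longrightarrow> \<exists>u\<in>verts G. \<exists>v\<in>verts G. ends G e = {u, v}"
    and bd_subset: "e \<in> edges G \<Longrightarrow> bd G \<alpha> e \<subseteq> ends G e"
    and bd_cover: "e \<in> edges G \<Longrightarrow> bd G Plus e \<union> bd G Minus e = ends G e"
    and bd_disjoint: "e \<in> edges G \<Longrightarrow> \<not> is_loop G e \<Longrightarrow> bd G Plus e \<inter> bd G Minus e = {}"

definition subgraph :: "('v, 'e) bigraph \<Rightarrow> ('v, 'e) bigraph \<Rightarrow> bool" where
  "subgraph H G \<longleftrightarrow> bidirected_graph H \<and> bidirected_graph G \<and>
     verts H \<subseteq> verts G \<and> edges H \<subseteq> edges G \<and>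
     (\<forall>e\<in>edges H. ends H e = ends G e \<and> (\<forall>\<alpha>. bd H \<alpha> e = bd G \<alpha> e))"

text \<open>
  A walk \<open>(w\<^sub>1, \<dots>, w\<^sub>k)\<close> is given by the list \<open>vs\<close> of its vertex terms and the list \<open>es\<close> of its edge
  terms, so that \<open>k = 2 * length es + 1\<close>.
\<close>

definition walk :: "('v, 'e) bigraph \<Rightarrow> 'v list \<Rightarrow> 'e list \<Rightarrow> bool" where
  "walk G vs es \<longleftrightarrow> length vs = Suc (length es) \<and> set vs \<subseteq> verts G \<and> set es \<subseteq> edges G \<and>
     (\<forall>i<length es. ends G (es ! i) = {vs ! i, vs ! Suc i})"

definition trail :: "('v, 'e) bigraph \<Rightarrow> 'v list \<Rightarrow> 'e list \<Rightarrow> bool" where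
  "trail G vs es \<longleftrightarrow> walk G vs es \<and> distinct es"

text \<open>
  \<open>s i\<close> and \<open>t i\<close> are the signs assigned to the first and to the second end-occurrence of the
  traversal of the edge \<open>es ! i\<close>.
\<close>

definition sign_assignment ::
  "('v, 'e) bigraph \<Rightarrow> 'v list \<Rightarrow> 'e list \<Rightarrow> (nat \<Rightarrow> sign) \<Rightarrow> (nat \<Rightarrow> sign) \<Rightarrow> bool" where
  "sign_assignment G vs es s t \<longleftrightarrow>
     (\<forall>i<length es. vs ! i \<in> bd G (s i) (es ! i) \<and> vs ! Suc i \<in> bd G (t i) (es ! i) \<and>
        (is_loop G (es ! i) \<and> bd G Plus (es ! i) \<inter> bd G Minus (es ! i) \<noteq> {} \<longrightarrow> s i \<noteq> t i)) \<and>
     (\<forall>i. Suc i < length es \<longrightarrow> t i \<noteq> s (Suc i))"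

definition diwalk :: "('v, 'e) bigraph \<Rightarrow> 'v list \<Rightarrow> 'e list \<Rightarrow> bool" where
  "diwalk G vs es \<longleftrightarrow> walk G vs es \<and> (\<exists>s t. sign_assignment G vs es s t)"

definition ditrail :: "('v, 'e) bigraph \<Rightarrow> 'v list \<Rightarrow> 'e list \<Rightarrow> bool" where
  "ditrail G vs es \<longleftrightarrow> diwalk G vs es \<and> trail G vs es"

text \<open>
  The two end signs need not be unique: a loop with both end signs may be traversed either way.
\<close>

definition signed_ditrail ::
  "sign \<Rightarrow> sign \<Rightarrow> ('v, 'e) bigraph \<Rightarrow> 'v list \<Rightarrow> 'e list \<Rightarrow> bool" where
  "signed_ditrail \<alpha> \<beta> G vs es \<longleftrightarrow> ditrail G vs es \<and>
     (if es = [] then \<alpha> \<noteq> \<beta>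
      else \<exists>s t. sign_assignment G vs es s t \<and> s 0 = \<alpha> \<and> t (length es - 1) = \<beta>)"

definition semiradial :: "sign \<Rightarrow> ('v, 'e) bigraph \<Rightarrow> 'v \<Rightarrow> bool" where
  "semiradial \<alpha> G r \<longleftrightarrow> bidirected_graph G \<and> r \<in> verts G \<and>
     (\<forall>v\<in>verts G. \<exists>\<beta> vs es. signed_ditrail \<alpha> \<beta> G vs es \<and> hd vs = v \<and> last vs = r)"

definition absolute_semiradial :: "('v, 'e) bigraph \<Rightarrow> 'v \<Rightarrow> bool" where
  "absolute_semiradial G r \<longleftrightarrow> (\<forall>\<alpha>. semiradial \<alpha> G r)"

text \<open>In a scoop diear, \<open>ces \<noteq> []\<close> expresses the length condition \<open>k \<ge> 7\<close>.\<close>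

definition scoop ::
  "('v, 'e) bigraph \<Rightarrow> ('v, 'e) bigraph \<Rightarrow> 'v list \<Rightarrow> 'e list \<Rightarrow> bool" where
  "scoop G H vs es \<longleftrightarrow>
     (\<exists>v w e cvs ces. vs = v # cvs @ [v] \<and> es = e # ces @ [e] \<and> ces \<noteq> [] \<and>
        ends G e = {v, w} \<and> v \<in> verts H \<and> w \<notin> verts H \<and>
        ditrail G cvs ces \<and> hd cvs = w \<and> last cvs = w \<and> e \<notin> set ces)"

definition diear ::
  "('v, 'e) bigraph \<Rightarrow> ('v, 'e) bigraph \<Rightarrow> 'v list \<Rightarrow> 'e list \<Rightarrow> bool" where
  "diear G H vs es \<longleftrightarrow> subgraph H G \<and> diwalk G vs es \<and>
     hd vs \<in> verts H \<and> last vs \<in> verts H \<and> set es \<inter> edges H = {} \<and>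
     (ditrail G vs es \<or> scoop G H vs es)"

text \<open>
  \<open>H + W\<close> for a walk \<open>W\<close> in a graph \<open>G\<close> that has \<open>H\<close> as a subgraph; the incidences of \<open>H\<close> and of the
  new edges are those of \<open>G\<close>.
\<close>

definition add_walk ::
  "('v, 'e) bigraph \<Rightarrow> ('v, 'e) bigraph \<Rightarrow> 'v list \<Rightarrow> 'e list \<Rightarrow> ('v, 'e) bigraph" where
  "add_walk G H vs es = G\<lparr>verts := verts H \<union> set vs, edges := edges H \<union> set es\<rparr>"

inductive_set diear_graphs :: "'v \<Rightarrow> ('v, 'e) bigraph set" for r :: 'v where
  single: "bidirected_graph G \<Longrightarrow> verts G = {r} \<Longrightarrow> edges G = {} \<Longrightarrow> G \<in> diear_graphs r"
| add: "H \<in> diear_graphs r \<Longrightarrow> diear G H vs es \<Longrightarrow> add_walk G H vs es \<in> diear_graphs r"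

end

theory Submission
  imports Defs
begin

text \<open>
  Every new vertex \<open>x\<close> of a diear \<open>W\<close> relative to an absolute semiradial \<open>H\<close> can be left along \<open>W\<close>
  in both directions, with opposite signs. Either way one arrives in \<open>H\<close> without repeating an edge,
  also if \<open>W\<close> is a scoop, and goes on to the root inside \<open>H\<close> with the sign opposite to that of the
  arrival.

  Conversely, let \<open>H\<close> be a subgraph of the absolute semiradial \<open>G\<close> that contains the root, with
  \<open>V(H) \<noteq> V(G)\<close>. Some edge \<open>e\<close> joins a vertex \<open>v\<close> of \<open>H\<close> to a vertex \<open>w\<close> outside, with sign \<open>\<alpha>\<close> at \<open>w\<close>
  say. Follow a \<open>-\<alpha>\<close>-ditrail from \<open>w\<close> to the root until it first meets \<open>H\<close>. Together with \<open>e\<close> this is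
  a diear: a simple one unless the ditrail returns through \<open>e\<close>, and then a scoop with grip \<open>e\<close>.
\<close>

section \<open>Signs, single traversals and signed walks\<close>

fun opp :: "sign \<Rightarrow> sign" where
  "opp Plus = Minus"
| "opp Minus = Plus"

lemma opp_opp [simp]: "opp (opp \<alpha>) = \<alpha>"
  by (cases \<alpha>) auto

text \<open>Turns the condition of distinct signs at internal vertices into an equation, so that one
  sign determines the next.\<close>

lemma neq_iff_opp: "\<alpha> \<noteq> \<beta> \<longleftrightarrow> \<beta> = opp \<alpha>"
  by (cases \<alpha>; cases \<beta>) auto

lemma opp_neq [simp]: "opp \<alpha> \<noteq> \<alpha>" "\<alpha> \<noteq> opp \<alpha>"
  by (cases \<alpha>; simp)+

text \<open>What \<open>walk\<close> and \<open>sign_assignment\<close> demand of a single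
  traversal, so that signed walks can be built edge by edge.\<close>

definition step :: "('v, 'e) bigraph \<Rightarrow> 'v \<Rightarrow> sign \<Rightarrow> 'e \<Rightarrow> sign \<Rightarrow> 'v \<Rightarrow> bool" where
  "step G u \<alpha> e \<beta> v \<longleftrightarrow> e \<in> edges G \<and> u \<in> verts G \<and> v \<in> verts G \<and> ends G e = {u, v} \<and>
     u \<in> bd G \<alpha> e \<and> v \<in> bd G \<beta> e \<and>
     (is_loop G e \<and> bd G Plus e \<inter> bd G Minus e \<noteq> {} \<longrightarrow> \<alpha> \<noteq> \<beta>)"

text \<open>
  With opposite signs at the two ends of a trivial walk, concatenation and reversal need no special
  case.
\<close>

inductive signed_walk :: "('v, 'e) bigraph \<Rightarrow> sign \<Rightarrow> sign \<Rightarrow> 'v list \<Rightarrow> 'e list \<Rightarrow> bool"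
  for G where
  Nil: "v \<in> verts G \<Longrightarrow> signed_walk G \<alpha> (opp \<alpha>) [v] []"
| Cons: "step G u \<alpha> e \<gamma> v \<Longrightarrow> signed_walk G (opp \<gamma>) \<beta> (v # vs) es \<Longrightarrow>
    signed_walk G \<alpha> \<beta> (u # v # vs) (e # es)"

lemma step_sym: "step G u \<alpha> e \<beta> v \<Longrightarrow> step G v \<beta> e \<alpha> u"
  unfolding step_def by auto

lemma (in bidirected_graph) edge_step:
  assumes "e \<in> edges G" "ends G e = {u, v}"
  shows "\<exists>\<alpha> \<beta>. step G u \<alpha> e \<beta> v"
proof -
  have V: "u \<in> verts G" "v \<in> verts G" using ends_pair[OF assms(1)] assms(2) by (auto simp: doubleton_eq_iff)
  have c: "u \<in> bd G Plus e \<or> u \<in> bd G Minus e" "v \<in> bd G Plus e \<or> v \<in> bd G Minus e"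
    using bd_cover[OF assms(1)] assms(2) by auto
  show ?thesis
  proof (cases "u = v")
    case True
    have "bd G \<alpha> e \<subseteq> {u}" for \<alpha> using bd_subset[OF assms(1)] assms(2) True by auto
    \<comment> \<open>A loop with both signs is traversed with opposite signs. A loop with only one
      sign gets it at both ends, and the loop condition is then void.\<close>
    then have "u \<in> bd G Plus e \<inter> bd G Minus e \<or> bd G Plus e \<inter> bd G Minus e = {}" by blast
    then show ?thesis using assms V c True unfolding step_def
      by (metis Int_iff sign.distinct(1))
  next
    case False
    then have "\<not> is_loop G e" unfolding is_loop_def assms(2) by (auto simp: doubleton_eq_iff)
    then show ?thesis using assms V c unfolding step_def by metis
  qed
qed

text \<open>Only a loop can have both signs at one vertex. When a ditrail runs back through a
  crossing edge, this gives the sign with which it leaves the outer end of that edge.\<close>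

lemma (in bidirected_graph) step_sign_unique:
  assumes "step G u \<alpha> e \<beta> v" "step G v' \<beta>' e \<alpha>' u" "u \<noteq> v"
  shows "\<alpha>' = \<alpha>"
proof (rule ccontr)
  assume "\<alpha>' \<noteq> \<alpha>"
  then have "u \<in> bd G Plus e \<inter> bd G Minus e"
    using assms(1,2) unfolding step_def by (cases \<alpha>; cases \<alpha>') auto
  moreover have "\<not> is_loop G e"
    using assms(1,3) unfolding is_loop_def step_def by (auto simp: doubleton_eq_iff)
  ultimately show False using bd_disjoint assms(1) unfolding step_def by auto
qed

section \<open>Agreement of signed walks with diwalks and ditrails\<close>

lemma signed_walk_nonempty: "signed_walk G \<alpha> \<beta> vs es \<Longrightarrow> vs \<noteq> []"
  by (induction rule: signed_walk.induct) auto

lemma signed_walk_edge: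
  "step G u \<alpha> e \<beta> v \<Longrightarrow> signed_walk G \<alpha> \<beta> [u, v] [e]"
  using signed_walk.Cons[OF _ signed_walk.Nil, of G u \<alpha> e \<beta> v] by (simp add: step_def)

lemma signed_walk_imp:
  assumes "signed_walk G \<alpha> \<beta> vs es"
  shows "walk G vs es \<and> (if es = [] then \<alpha> \<noteq> \<beta>
      else \<exists>s t. sign_assignment G vs es s t \<and> s 0 = \<alpha> \<and> t (length es - 1) = \<beta>)"
  using assms
proof (induction rule: signed_walk.induct)
  case (Nil v \<alpha>)
  then show ?case by (simp add: walk_def)
next
  case (Cons u \<alpha> e \<gamma> v \<beta> vs es)
  have w: "walk G (u # v # vs) (e # es)"
    using Cons.IH Cons.hyps(1) unfolding walk_def step_def by (auto simp: nth_Cons split: nat.split)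
  have "\<exists>s t. sign_assignment G (u # v # vs) (e # es) s t \<and> s 0 = \<alpha> \<and> t (length es) = \<beta>"
  proof (cases "es = []")
    case True
    \<comment> \<open>The trivial remainder has end signs \<open>opp \<gamma>\<close> and
      \<open>\<beta>\<close>, which are opposite.\<close>
    then have "\<beta> = \<gamma>" using Cons.IH by (simp add: neq_iff_opp)
    then have "sign_assignment G (u # v # vs) (e # es) (\<lambda>_. \<alpha>) (\<lambda>_. \<beta>)"
      using Cons.hyps(1) True unfolding sign_assignment_def step_def by auto
    then show ?thesis by (intro exI[of _ "\<lambda>_. \<alpha>"] exI[of _ "\<lambda>_. \<beta>"]) simp
  next
    case False
    then obtain s t where st: "sign_assignment G (v # vs) es s t" "s 0 = opp \<gamma>"
      "t (length es - 1) = \<beta>" using Cons.IH by auto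
    \<comment> \<open>\<open>case_nat\<close> puts the signs of the new edge at index 0 and shifts
      the old assignment by one.\<close>
    have "sign_assignment G (u # v # vs) (e # es) (case_nat \<alpha> s) (case_nat \<gamma> t)"
      using Cons.hyps(1) st unfolding sign_assignment_def step_def
      by (auto split: nat.split)
    moreover have "case_nat \<gamma> t (length es) = \<beta>" using False st by (cases es) auto
    ultimately show ?thesis by (intro exI[of _ "case_nat \<alpha> s"] exI[of _ "case_nat \<gamma> t"]) simp
  qed
  then show ?case using w by simp
qed

lemma signed_walk_if_sign_assignment:
  assumes "walk G vs es" "es \<noteq> []" "sign_assignment G vs es s t"
  shows "signed_walk G (s 0) (t (length es - 1)) vs es"
  using assms
proof (induction es arbitrary: vs s t)
  case Nil
  then show ?case by simp
next
  case (Cons e es)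
  obtain u v ws where vs: "vs = u # v # ws"
    using Cons.prems(1) unfolding walk_def by (auto simp: length_Suc_conv)
  have st: "step G u (s 0) e (t 0) v"
    using Cons.prems(1,3) unfolding vs walk_def sign_assignment_def step_def by auto
  show ?case
  proof (cases "es = []")
    case True
    then show ?thesis using Cons.prems(1) signed_walk_edge[OF st] unfolding vs walk_def by simp
  next
    case False
    have "walk G (v # ws) es" using Cons.prems(1) unfolding vs walk_def by auto
    moreover have "sign_assignment G (v # ws) es (\<lambda>i. s (Suc i)) (\<lambda>i. t (Suc i))"
      using Cons.prems(3) unfolding vs sign_assignment_def by auto
    ultimately have "signed_walk G (s 1) (t (length es)) (v # ws) es"
      using Cons.IH[OF _ False, of "v # ws" "\<lambda>i. s (Suc i)" "\<lambda>i. t (Suc i)"] False by simp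
    moreover have "s 1 = opp (t 0)"
      using Cons.prems(3) False unfolding sign_assignment_def by (simp add: neq_iff_opp)
    ultimately show ?thesis using st unfolding vs by (auto intro: signed_walk.Cons)
  qed
qed

lemma signed_walk_iff:
  "signed_walk G \<alpha> \<beta> vs es \<longleftrightarrow> walk G vs es \<and> (if es = [] then \<alpha> \<noteq> \<beta>
      else \<exists>s t. sign_assignment G vs es s t \<and> s 0 = \<alpha> \<and> t (length es - 1) = \<beta>)"
  (is "_ \<longleftrightarrow> ?R")
proof
  assume R: ?R
  show "signed_walk G \<alpha> \<beta> vs es"
  proof (cases "es = []")
    case True
    then obtain v where "vs = [v]" "v \<in> verts G" "\<beta> = opp \<alpha>"
      using R unfolding walk_def by (auto simp: length_Suc_conv neq_iff_opp)
    then show ?thesis using True by (auto intro: signed_walk.Nil)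
  next
    case False
    then show ?thesis using R signed_walk_if_sign_assignment by fastforce
  qed
qed (rule signed_walk_imp)

lemma diwalk_iff: "diwalk G vs es \<longleftrightarrow> (\<exists>\<alpha> \<beta>. signed_walk G \<alpha> \<beta> vs es)"
  unfolding diwalk_def signed_walk_iff sign_assignment_def
  by (cases "es = []") (auto simp: neq_iff_opp)

lemma ditrail_iff: "ditrail G vs es \<longleftrightarrow> (\<exists>\<alpha> \<beta>. signed_walk G \<alpha> \<beta> vs es) \<and> distinct es"
  unfolding ditrail_def trail_def diwalk_iff by (auto simp: signed_walk_iff)

lemma signed_ditrail_iff: "signed_ditrail \<alpha> \<beta> G vs es \<longleftrightarrow> signed_walk G \<alpha> \<beta> vs es \<and> distinct es"
  unfolding signed_ditrail_def ditrail_iff by (auto simp: signed_walk_iff split: if_splits)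

section \<open>Concatenating, reversing, transferring and cutting signed walks\<close>

lemma signed_walk_append:
  assumes "signed_walk G \<alpha> \<beta> vs es" "signed_walk G (opp \<beta>) \<gamma> (last vs # ws) fs"
  shows "signed_walk G \<alpha> \<gamma> (vs @ ws) (es @ fs)"
  using assms by (induction rule: signed_walk.induct) (auto intro: signed_walk.Cons)

lemma signed_walk_rev:
  assumes "signed_walk G \<alpha> \<beta> vs es"
  shows "signed_walk G \<beta> \<alpha> (rev vs) (rev es)"
  using assms
proof (induction rule: signed_walk.induct)
  case (Nil v \<alpha>)
  then show ?case using signed_walk.Nil[of v G "opp \<alpha>"] by simp
next
  case (Cons u \<alpha> e \<gamma> v \<beta> vs es)
  have "signed_walk G \<gamma> \<alpha> [v, u] [e]" 
    by (rule signed_walk_edge[OF step_sym[OF Cons.hyps(1)]])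
  then show ?case using signed_walk_append[OF Cons.IH, of \<alpha> "[u]" "[e]"] by simp
qed

lemma signed_walk_verts: "signed_walk G \<alpha> \<beta> vs es \<Longrightarrow> set vs \<subseteq> verts G"
  and signed_walk_edges: "signed_walk G \<alpha> \<beta> vs es \<Longrightarrow> set es \<subseteq> edges G"
  by (auto simp: signed_walk_iff walk_def)

lemma signed_walk_ends:
  "signed_walk G \<alpha> \<beta> vs es \<Longrightarrow> e \<in> set es \<Longrightarrow> \<exists>u\<in>set vs. \<exists>v\<in>set vs. ends G e = {u, v}"
proof (induction rule: signed_walk.induct)
  case (Cons u \<alpha> f \<gamma> v \<beta> vs es)
  have "ends G f = {u, v}" using Cons.hyps(1) by (simp add: step_def)
  then show ?case using Cons.IH Cons.prems by (cases "e = f") (simp_all, blast+)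
qed simp

text \<open>A signed walk sees only the incidences of its own edges, so it carries over to a larger
  graph as well as to a subgraph that contains it.\<close>

lemma signed_walk_cong:
  assumes "signed_walk G \<alpha> \<beta> vs es" "set vs \<subseteq> verts K" "set es \<subseteq> edges K"
    and "\<And>e. e \<in> set es \<Longrightarrow> ends K e = ends G e \<and> (\<forall>\<alpha>. bd K \<alpha> e = bd G \<alpha> e)"
  shows "signed_walk K \<alpha> \<beta> vs es"
  using assms
proof (induction rule: signed_walk.induct)
  case (Nil v \<alpha>)
  then show ?case by (auto intro: signed_walk.Nil)
next
  case (Cons u \<alpha> e \<gamma> v \<beta> vs es)
  have "step K u \<alpha> e \<gamma> v" using Cons.hyps(1) Cons.prems by (auto simp: step_def is_loop_def)
  then show ?case using Cons by (auto intro: signed_walk.Cons)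
qed

lemma signed_walk_subgraph:
  assumes "signed_walk H \<alpha> \<beta> vs es" "subgraph H G"
  shows "signed_walk G \<alpha> \<beta> vs es"
proof (rule signed_walk_cong[OF assms(1)])
  show "set vs \<subseteq> verts G" "set es \<subseteq> edges G"
    using signed_walk_verts[OF assms(1)] signed_walk_edges[OF assms(1)] assms(2)
    unfolding subgraph_def by auto
  show "ends G e = ends H e \<and> (\<forall>\<alpha>. bd G \<alpha> e = bd H \<alpha> e)" if "e \<in> set es" for e
    using that signed_walk_edges[OF assms(1)] assms(2) unfolding subgraph_def by auto
qed

text \<open>The signs \<open>\<delta>\<close> of arrival and \<open>opp \<delta>\<close> of
  departure at \<open>x\<close> are opposite, which later allows \<open>x\<close> to be left with
  either sign. At an end of the walk one piece may be trivial.\<close>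

lemma signed_walk_split:
  assumes "signed_walk G \<alpha> \<beta> vs es" "x \<in> set vs"
  shows "\<exists>vs1 es1 \<delta> vs2 es2. es = es1 @ es2 \<and> signed_walk G \<alpha> \<delta> vs1 es1 \<and>
    signed_walk G (opp \<delta>) \<beta> vs2 es2 \<and> set vs1 \<subseteq> set vs \<and> set vs2 \<subseteq> set vs \<and>
    hd vs1 = hd vs \<and> last vs1 = x \<and> hd vs2 = x \<and> last vs2 = last vs"
  using assms
proof (induction rule: signed_walk.induct)
  case (Nil v \<alpha>)
  then show ?case
    by (intro exI[of _ "[v]"] exI[of _ "[]"] exI[of _ "opp \<alpha>"]) (auto intro: signed_walk.Nil)
next
  case (Cons u \<alpha> e \<gamma> v \<beta> vs es)
  show ?case
  proof (cases "x = u")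
    case True
    have u: "u \<in> verts G" using Cons.hyps(1) by (simp add: step_def)
    show ?thesis using signed_walk.Nil[OF u, of \<alpha>] signed_walk.Cons[OF Cons.hyps] True
      by (intro exI[of _ "[u]"] exI[of _ "[]"] exI[of _ "opp \<alpha>"] exI[of _ "u # v # vs"]
          exI[of _ "e # es"]) auto
  next
    case False
    then obtain vs1 es1 \<delta> vs2 es2 where IH: "es = es1 @ es2" "signed_walk G (opp \<gamma>) \<delta> vs1 es1"
      "signed_walk G (opp \<delta>) \<beta> vs2 es2" "set vs1 \<subseteq> set (v # vs)" "set vs2 \<subseteq> set (v # vs)"
      "hd vs1 = v" "last vs1 = x" "hd vs2 = x" "last vs2 = last (v # vs)"
      using Cons.IH Cons.prems by auto
    obtain ws where "vs1 = v # ws" using IH(6) signed_walk_nonempty[OF IH(2)] by (cases vs1) auto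
    then show ?thesis using IH signed_walk.Cons[OF Cons.hyps(1)]
      by (intro exI[of _ "u # v # ws"] exI[of _ "e # es1"] exI[of _ \<delta>] exI[of _ vs2]
          exI[of _ es2]) auto
  qed
qed

text \<open>The edge \<open>e\<close> that enters \<open>S\<close> is kept apart from the piece
  before it, which avoids \<open>S\<close>: whether this edge is the one used to leave
  \<open>S\<close> decides between a simple diear and a scoop.\<close>

lemma signed_walk_first_hit:
  assumes "signed_walk G \<alpha> \<beta> vs es" "hd vs \<notin> S" "last vs \<in> S"
  shows "\<exists>vs1 es1 \<gamma> e \<delta> x es2. es = es1 @ e # es2 \<and> signed_walk G \<alpha> \<gamma> vs1 es1 \<and>
    hd vs1 = hd vs \<and> set vs1 \<inter> S = {} \<and> step G (last vs1) (opp \<gamma>) e \<delta> x \<and> x \<in> S"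
  using assms
proof (induction rule: signed_walk.induct)
  case (Nil v \<alpha>)
  then show ?case by simp
next
  case (Cons u \<alpha> e \<gamma> v \<beta> vs es)
  show ?case
  proof (cases "v \<in> S")
    case True
    have u: "u \<in> verts G" using Cons.hyps(1) by (simp add: step_def)
    show ?thesis using signed_walk.Nil[OF u, of \<alpha>] Cons.hyps(1) True Cons.prems
      by (intro exI[of _ "[u]"] exI[of _ "[]"] exI[of _ "opp \<alpha>"] exI[of _ e] exI[of _ \<gamma>]
          exI[of _ v] exI[of _ es]) auto
  next
    case False
    then obtain vs1 es1 \<gamma>' f \<delta> x es2 where IH: "es = es1 @ f # es2"
      "signed_walk G (opp \<gamma>) \<gamma>' vs1 es1" "hd vs1 = v" "set vs1 \<inter> S = {}"
      "step G (last vs1) (opp \<gamma>') f \<delta> x" "x \<in> S"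
      using Cons.IH Cons.prems by auto
    obtain ws where "vs1 = v # ws" using IH(3) signed_walk_nonempty[OF IH(2)] by (cases vs1) auto
    then show ?thesis using IH signed_walk.Cons[OF Cons.hyps(1)] Cons.prems(1)
      by (intro exI[of _ "u # v # ws"] exI[of _ "e # es1"] exI[of _ \<gamma>'] exI[of _ f] exI[of _ \<delta>]
          exI[of _ x] exI[of _ es2]) auto
  qed
qed

section \<open>Adding a diear preserves absolute semiradials\<close>

lemma add_walk_subgraph:
  assumes "subgraph H G" "diwalk G vs es"
  shows "subgraph H (add_walk G H vs es)" "subgraph (add_walk G H vs es) G"
proof -
  let ?K = "add_walk G H vs es"
  obtain \<alpha> \<beta> where w: "signed_walk G \<alpha> \<beta> vs es" using assms(2) diwalk_iff by metis
  interpret H: bidirected_graph H using assms(1) by (simp add: subgraph_def)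
  interpret G: bidirected_graph G using assms(1) by (simp add: subgraph_def)
  have sub: "verts H \<subseteq> verts G" "edges H \<subseteq> edges G"
    "\<forall>e\<in>edges H. ends H e = ends G e \<and> (\<forall>\<alpha>. bd H \<alpha> e = bd G \<alpha> e)"
    using assms(1) by (auto simp: subgraph_def)
  have K: "verts ?K \<subseteq> verts G" "edges ?K \<subseteq> edges G"
    using sub signed_walk_verts[OF w] signed_walk_edges[OF w] by (auto simp: add_walk_def)
  have b: "bidirected_graph ?K"
  proof
    show "finite (verts ?K)" "finite (edges ?K)"
      using K G.finite_verts G.finite_edges by (auto intro: finite_subset)
    fix e assume e: "e \<in> edges ?K"
    then have eG: "e \<in> edges G" using K by auto
    show "\<exists>u\<in>verts ?K. \<exists>v\<in>verts ?K. ends ?K e = {u, v}"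
    proof (cases "e \<in> edges H")
      case True
      then show ?thesis using H.ends_pair[OF True] sub(3) by (fastforce simp: add_walk_def)
    next
      case False
      then have "e \<in> set es" using e by (simp add: add_walk_def)
      then show ?thesis using signed_walk_ends[OF w] by (fastforce simp: add_walk_def)
    qed
    show "bd ?K \<alpha> e \<subseteq> ends ?K e" for \<alpha> using G.bd_subset[OF eG] by (simp add: add_walk_def)
    show "bd ?K Plus e \<union> bd ?K Minus e = ends ?K e"
      using G.bd_cover[OF eG] by (simp add: add_walk_def)
    show "bd ?K Plus e \<inter> bd ?K Minus e = {}" if "\<not> is_loop ?K e"
      using G.bd_disjoint[OF eG] that by (simp add: add_walk_def is_loop_def)
  qed
  show "subgraph H ?K" "subgraph ?K G"
    using assms(1) b K sub unfolding subgraph_def by (auto simp: add_walk_def)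
qed

text \<open>With \<open>W\<close> cut at \<open>x\<close>, the second piece leaves \<open>x\<close>
  with one sign and the reversed first piece with the other. That the edges stay in \<open>W\<close>
  keeps them disjoint from those of \<open>H\<close>.\<close>

lemma diear_leave:
  assumes "diear G H vs es" "x \<in> set vs" "x \<notin> verts H"
  shows "\<exists>\<beta> us fs. signed_walk G \<alpha> \<beta> us fs \<and> distinct fs \<and> hd us = x \<and> last us \<in> verts H \<and>
    set us \<subseteq> set vs \<and> set fs \<subseteq> set es"
proof -
  obtain \<alpha>0 \<beta>0 where w: "signed_walk G \<alpha>0 \<beta>0 vs es"
    using assms(1) unfolding diear_def diwalk_iff by blast
  have H: "hd vs \<in> verts H" "last vs \<in> verts H" using assms(1) unfolding diear_def by auto
  obtain vs1 es1 \<delta> vs2 es2 where s: "es = es1 @ es2" "signed_walk G \<alpha>0 \<delta> vs1 es1"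
    "signed_walk G (opp \<delta>) \<beta>0 vs2 es2" "set vs1 \<subseteq> set vs" "set vs2 \<subseteq> set vs"
    "hd vs1 = hd vs" "last vs1 = x" "hd vs2 = x" "last vs2 = last vs"
    using signed_walk_split[OF w assms(2)] by blast
  have "distinct es1 \<and> distinct es2"
  proof (cases "ditrail G vs es")
    case True
    then show ?thesis using s(1) by (auto simp: ditrail_iff)
  next
    case False
    then have "scoop G H vs es" using assms(1) unfolding diear_def by auto
    then obtain e ces where c: "es = e # ces @ [e]" "distinct ces" "e \<notin> set ces"
      unfolding scoop_def ditrail_iff by blast
    \<comment> \<open>A trivial piece would make \<open>x\<close> an end of \<open>W\<close> and so
      a vertex of \<open>H\<close>. Hence the two occurrences of the grip fall into different
      pieces, and neither piece repeats an edge.\<close>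
    have "es1 \<noteq> []" using s(2,6,7) H(1) assms(3) by (auto elim: signed_walk.cases)
    then obtain a where a: "es1 = e # a" using s(1) c(1) by (cases es1) auto
    have "es2 \<noteq> []" using s(3,8,9) H(2) assms(3) by (auto elim: signed_walk.cases)
    then obtain b where b: "es2 = b @ [e]"
      using s(1) c(1) by (cases es2 rule: rev_cases) (auto simp: a)
    have "a @ b = ces" using s(1) c(1) a b by simp
    then show ?thesis using c a b by auto
  qed
  then have d: "distinct es1" "distinct es2" by auto
  show ?thesis
  proof (cases "\<alpha> = \<delta>")
    case True
    have "vs1 \<noteq> []" using s(2) by (rule signed_walk_nonempty)
    then show ?thesis using signed_walk_rev[OF s(2)] True d s H
      by (intro exI[of _ \<alpha>0] exI[of _ "rev vs1"] exI[of _ "rev es1"])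
        (auto simp: hd_rev last_rev)
  next
    case False
    then have "\<alpha> = opp \<delta>" using neq_iff_opp by metis
    then show ?thesis using d s H
      by (intro exI[of _ \<beta>0] exI[of _ vs2] exI[of _ es2]) auto
  qed
qed

lemma absolute_semiradial_iff:
  "absolute_semiradial G r \<longleftrightarrow> bidirected_graph G \<and> r \<in> verts G \<and>
    (\<forall>\<alpha>. \<forall>v\<in>verts G. \<exists>\<beta> vs es. signed_walk G \<alpha> \<beta> vs es \<and> distinct es \<and> hd vs = v \<and> last vs = r)"
  unfolding absolute_semiradial_def semiradial_def signed_ditrail_iff by blast

lemma absolute_semiradial_add_walk:
  assumes "absolute_semiradial H r" "diear G H vs es"
  shows "absolute_semiradial (add_walk G H vs es) r"
proof -
  let ?K = "add_walk G H vs es"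
  have dw: "subgraph H G" "diwalk G vs es" "set es \<inter> edges H = {}"
    using assms(2) by (auto simp: diear_def)
  note sub = add_walk_subgraph[OF dw(1,2)]
  have ex: "\<exists>\<beta> us fs. signed_walk ?K \<alpha> \<beta> us fs \<and> distinct fs \<and> hd us = x \<and> last us = r"
    if x: "x \<in> verts ?K" for \<alpha> x
  proof (cases "x \<in> verts H")
    case True
    then show ?thesis
      using assms(1) signed_walk_subgraph[OF _ sub(1)] unfolding absolute_semiradial_iff by blast
  next
    case False
    then have "x \<in> set vs" using x by (simp add: add_walk_def)
    then obtain \<beta> us fs where u: "signed_walk G \<alpha> \<beta> us fs" "distinct fs" "hd us = x"
      "last us \<in> verts H" "set us \<subseteq> set vs" "set fs \<subseteq> set es"
      using diear_leave[OF assms(2) _ False] by blast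
    have uK: "signed_walk ?K \<alpha> \<beta> us fs"
      by (rule signed_walk_cong[OF u(1)]) (use u(5,6) in \<open>auto simp: add_walk_def\<close>)
    \<comment> \<open>The start sign \<open>opp \<beta>\<close> makes the two ditrails fit together.
      It is available because \<open>H\<close> is a semiradial for both signs.\<close>
    obtain \<gamma> ws gs where w: "signed_walk H (opp \<beta>) \<gamma> ws gs" "distinct gs" "hd ws = last us"
      "last ws = r"
      using assms(1) u(4) unfolding absolute_semiradial_iff by blast
    obtain ws' where ws': "ws = last us # ws'"
      using w(3) signed_walk_nonempty[OF w(1)] by (cases ws) auto
    have "signed_walk ?K \<alpha> \<gamma> (us @ ws') (fs @ gs)"
      using signed_walk_append[OF uK] signed_walk_subgraph[OF w(1) sub(1)] ws' by blast
    moreover have "distinct (fs @ gs)"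
      using u(2,6) w(2) signed_walk_edges[OF w(1)] dw(3) by auto
    moreover have "hd (us @ ws') = x" "last (us @ ws') = r"
      using signed_walk_nonempty[OF u(1)] u(3) w(4) ws' by auto
    ultimately show ?thesis by blast
  qed
  have "bidirected_graph ?K" using sub(1) by (simp add: subgraph_def)
  moreover have "r \<in> verts ?K"
    using assms(1) by (simp add: absolute_semiradial_iff add_walk_def)
  ultimately show ?thesis using ex unfolding absolute_semiradial_iff by blast
qed

lemma diear_graphs_absolute_semiradial:
  "G \<in> diear_graphs r \<Longrightarrow> absolute_semiradial G r"
proof (induction rule: diear_graphs.induct)
  case (single G)
  \<comment> \<open>The trivial ditrail may start with either sign.\<close>
  then have "signed_walk G \<alpha> (opp \<alpha>) [r] []" for \<alpha> by (intro signed_walk.Nil) simp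
  then show ?case using single unfolding absolute_semiradial_iff by fastforce
next
  case (add H G vs es)
  then show ?case by (intro absolute_semiradial_add_walk)
qed

section \<open>Building an absolute semiradial from its root by diears\<close>

text \<open>If no vertex of \<open>G\<close> is missing in \<open>H\<close>, any missing edge is a
  simple diear by itself; otherwise the diear starts with an edge that leaves \<open>H\<close>. That
  \<open>es\<close> is nonempty guarantees progress when the diear is added.\<close>

lemma ex_diear:
  assumes G: "absolute_semiradial G r" and H: "subgraph H G" "r \<in> verts H"
    and proper: "\<not> verts G \<subseteq> verts H \<or> edges G \<noteq> edges H"
  shows "\<exists>vs es. diear G H vs es \<and> es \<noteq> []"
proof (cases "verts G \<subseteq> verts H")
  case True
  interpret bidirected_graph G using H by (simp add: subgraph_def)
  obtain e where e: "e \<in> edges G" "e \<notin> edges H"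
    using True proper H(1) by (auto simp: subgraph_def)
  obtain u v where uv: "u \<in> verts G" "v \<in> verts G" "ends G e = {u, v}"
    using ends_pair[OF e(1)] by blast
  obtain \<alpha> \<beta> where "signed_walk G \<alpha> \<beta> [u, v] [e]"
    using edge_step[OF e(1) uv(3)] signed_walk_edge by metis
  then have "ditrail G [u, v] [e]" by (auto simp: ditrail_iff)
  then have "diear G H [u, v] [e]"
    using H(1) e uv True by (auto simp: diear_def ditrail_def)
  then show ?thesis by blast
next
  case False
  interpret H: bidirected_graph H using H by (simp add: subgraph_def)
  interpret bidirected_graph G using H by (simp add: subgraph_def)
  let ?S = "verts H"
  have ends_H: "ends G e \<subseteq> ?S" if "e \<in> edges H" for e
    using H.ends_pair[OF that] that H(1) by (auto simp: subgraph_def)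
  obtain x where x: "x \<in> verts G" "x \<notin> ?S" using False by auto
  \<comment> \<open>The sign \<open>Plus\<close> is an arbitrary choice: this walk only serves to
    find an edge between \<open>H\<close> and the outside.\<close>
  obtain \<beta>0 us0 fs0 where p: "signed_walk G Plus \<beta>0 us0 fs0" "hd us0 = x" "last us0 = r"
    using G x(1) unfolding absolute_semiradial_iff by blast
  obtain vs0 es0 \<gamma>0 e \<mu> v where c: "signed_walk G Plus \<gamma>0 vs0 es0" "set vs0 \<inter> ?S = {}"
    "step G (last vs0) (opp \<gamma>0) e \<mu> v" "v \<in> ?S"
    using signed_walk_first_hit[OF p(1), of ?S] p(2,3) x(2) H(2) by auto
  define w where "w = last vs0"
  \<comment> \<open>The sign of \<open>w\<close> over \<open>e\<close>. A ditrail that continues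
    \<open>e\<close> beyond \<open>w\<close> has to start with \<open>opp \<alpha>\<close>.\<close>
  define \<alpha> where "\<alpha> = opp \<gamma>0"
  have cross: "step G w \<alpha> e \<mu> v" "v \<in> ?S" "w \<notin> ?S"
    using c signed_walk_nonempty[OF c(1)] last_in_set by (auto simp: w_def \<alpha>_def)
  have "w \<in> verts G" using cross(1) by (simp add: step_def)
  then obtain \<beta> us fs where t: "signed_walk G (opp \<alpha>) \<beta> us fs" "distinct fs" "hd us = w"
    "last us = r"
    using G unfolding absolute_semiradial_iff by blast
  \<comment> \<open>The edge \<open>f\<close> of first return to \<open>H\<close> may be
    \<open>e\<close> itself, now traversed from \<open>w\<close> to \<open>v\<close>.\<close>
  obtain vs1 es1 \<gamma> f \<delta> y es2 where h: "fs = es1 @ f # es2" "signed_walk G (opp \<alpha>) \<gamma> vs1 es1"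
    "hd vs1 = w" "set vs1 \<inter> ?S = {}" "step G (last vs1) (opp \<gamma>) f \<delta> y" "y \<in> ?S"
    using signed_walk_first_hit[OF t(1), of ?S] t(3,4) cross(3) H(2) by auto
  let ?vs = "v # vs1 @ [y]" and ?es = "e # es1 @ [f]"
  have ne: "vs1 \<noteq> []" using h(2) by (rule signed_walk_nonempty)
  then obtain ws where ws: "vs1 = w # ws" using h(3) by (cases vs1) auto
  have lastS: "last vs1 \<notin> ?S" using h(4) ne last_in_set by blast
  have "signed_walk G (opp \<alpha>) \<delta> (vs1 @ [y]) (es1 @ [f])"
    using h(2) signed_walk_edge[OF h(5)] by (rule signed_walk_append)
  then have W: "signed_walk G \<mu> \<delta> ?vs ?es"
    using signed_walk.Cons[OF step_sym[OF cross(1)]] ws by auto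
  \<comment> \<open>All ends of the edges before \<open>f\<close> lie outside \<open>H\<close>,
    whereas \<open>e\<close> has the end \<open>v\<close> in \<open>H\<close>.\<close>
  have out: "e' \<notin> edges H \<and> e' \<noteq> e" if e': "e' \<in> set es1" for e'
  proof -
    have "ends G e' \<noteq> {}" "ends G e' \<inter> ?S = {}"
      using signed_walk_ends[OF h(2) e'] h(4) by auto
    moreover have "v \<in> ends G e" using cross(1) by (simp add: step_def)
    ultimately show ?thesis using ends_H[of e'] cross(2) by blast
  qed
  have "e \<notin> edges H" "f \<notin> edges H"
    using ends_H cross lastS h(5) by (auto simp: step_def)
  then have new: "set ?es \<inter> edges H = {}" using out by auto
  have dist: "distinct (es1 @ [f])" using t(2) h(1) by auto
  have "ditrail G ?vs ?es \<or> scoop G H ?vs ?es"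
  proof (cases "f = e")
    case False
    then show ?thesis using W dist out by (auto simp: ditrail_iff)
  next
    case True
    have "{last vs1, y} = {w, v}" using h(5) cross(1) True by (simp add: step_def)
    then have yw: "y = v" "last vs1 = w"
      using h(6) cross(2,3) lastS by (auto simp: doubleton_eq_iff)
    have "w \<noteq> v" using cross by auto
    then have \<gamma>: "opp \<gamma> = \<alpha>"
      using step_sign_unique[OF cross(1) step_sym[OF h(5)[unfolded yw True]]] by simp
    \<comment> \<open>A trivial walk with first sign \<open>opp \<alpha>\<close> would have
      \<open>\<gamma> = \<alpha>\<close>, against \<open>opp \<gamma> = \<alpha>\<close>. This
      yields the length condition of a scoop.\<close>
    have "es1 \<noteq> []"
      using h(2) \<gamma> by (auto elim: signed_walk.cases)
    moreover have "ditrail G vs1 es1" using h(2) dist by (auto simp: ditrail_iff)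
    ultimately have "scoop G H ?vs ?es"
      unfolding scoop_def using True yw out cross h(3)
      by (intro exI[of _ v] exI[of _ w] exI[of _ e] exI[of _ vs1] exI[of _ es1])
        (auto simp: step_def)
    then show ?thesis by simp
  qed
  then have "diear G H ?vs ?es"
    unfolding diear_def diwalk_iff using H(1) W cross(2) h(6) new by auto
  then show ?thesis by blast
qed

text \<open>Induction on the number of edges of \<open>G\<close> missing in \<open>H\<close>. Each
  added diear contributes a new edge, and the enlarged graph is still a subgraph of
  \<open>G\<close>.\<close>

lemma diear_graphs_if_subgraph:
  assumes "absolute_semiradial G r" "H \<in> diear_graphs r" "subgraph H G"
  shows "G \<in> diear_graphs r"
  using assms(2,3)
proof (induction "card (edges G - edges H)" arbitrary: H rule: less_induct)
  case less
  have r: "r \<in> verts H"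
    using diear_graphs_absolute_semiradial[OF less.prems(1)] by (simp add: absolute_semiradial_iff)
  show ?case
  proof (cases "verts G \<subseteq> verts H \<and> edges G = edges H")
    case True
    then have V: "verts G = verts H" using less.prems(2) by (auto simp: subgraph_def)
    have "signed_walk G Plus Minus [r] []" using signed_walk.Nil[of r G Plus] r V by simp
    then have "diear G H [r] []"
      unfolding diear_def diwalk_iff ditrail_iff using less.prems(2) r by auto
    \<comment> \<open>The trivial diear replaces the values of \<open>H\<close> outside its edges by those of \<open>G\<close>.\<close>
    then have "add_walk G H [r] [] \<in> diear_graphs r" using less.prems(1) by (intro diear_graphs.add)
    moreover have "add_walk G H [r] [] = G"
      using True V r by (simp add: add_walk_def insert_absorb)
    ultimately show ?thesis by simp
  next
    case False
    then obtain vs es where d: "diear G H vs es" "es \<noteq> []"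
      using ex_diear[OF assms(1) less.prems(2) r] by blast
    let ?K = "add_walk G H vs es"
    have K: "subgraph ?K G" using add_walk_subgraph(2) d(1) by (auto simp: diear_def)
    have "set es \<subseteq> edges G" using K by (simp add: subgraph_def add_walk_def)
    moreover have "set es \<inter> edges H = {}" using d(1) by (simp add: diear_def)
    moreover have "hd es \<in> set es" using d(2) by simp
    ultimately have "edges G - edges ?K \<subset> edges G - edges H" by (auto simp: add_walk_def)
    moreover have "finite (edges G)"
      using assms(1) by (simp add: absolute_semiradial_iff bidirected_graph_def)
    ultimately have "card (edges G - edges ?K) < card (edges G - edges H)"
      by (intro psubset_card_mono) auto
    then show ?thesis using less.hyps K diear_graphs.add[OF less.prems(1) d(1)] by blast
  qed
qed

lemma absolute_semiradial_diear_graphs: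
  assumes "absolute_semiradial G r"
  shows "G \<in> diear_graphs r"
proof (rule diear_graphs_if_subgraph[OF assms])
  \<comment> \<open>The root alone starts the construction; the values of \<open>ends\<close> and
    \<open>bd\<close> are immaterial here, as there are no edges.\<close>
  let ?H = "G\<lparr>verts := {r}, edges := {}\<rparr>"
  have H: "bidirected_graph ?H" by standard auto
  then show "?H \<in> diear_graphs r" by (intro diear_graphs.single) auto
  show "subgraph ?H G" using H assms by (auto simp: subgraph_def absolute_semiradial_iff)
qed

theorem theorem8p3:
  fixes r :: 'v
  shows "(diear_graphs r :: ('v, 'e) bigraph set) = {G. absolute_semiradial G r}"
  by (rule set_eqI, unfold mem_Collect_eq, rule iffI)
    (erule diear_graphs_absolute_semiradial absolute_semiradial_diear_graphs)+

end
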